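(* Let $S_a$ be the set of tiles composed of the domino, the L-tile, the 3-bar and the T-tile, where all tiles may be rotated. There exists an algorithm which, given a connected polyomino $R$ in the plane $\mathbb{Z}^2$ of size $n=|R|$, decides in time polynomial in $n$ whether $R$ can be tiled with the set $S_a$.
   Context: A polyomino in the plane is a finite connected union of unit squares of the grid $\mathbb{Z}^2$ (connected through shared sides), possibly with holes; its size is the number of unit squares. Denoting unit squares by integer coordinates, the tiles are: domino $\{(0,0),(1,0)\}$; L-tile $\{(0,0),(1,0),(0,1)\}$; 3-bar $\{(0,0),(1,0),(2,0)\}$; T-tile $\{(0,0),(1,0),(2,0),(1,1)\}$. A copy of a tile is any image of it under rotation by a multiple of $90^\circ$ and integer translation. $R$ can be tiled with $S_a$ if it can be entirely covered, without overlap and without leaving $R$, by any number of copies of tiles of $S_a$. *)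

theory Defs
  imports Main "HOL-Library.Disjoint_Sets" "HOL-Computational_Algebra.Polynomial"
begin

section \<open>Polyominoes and tilings\<close>

text \<open>A unit square of the grid is named by the integer coordinates of its lower left corner.\<close>

type_synonym cell = "int \<times> int"

definition adjacent :: "cell \<Rightarrow> cell \<Rightarrow> bool" where
  "adjacent c d \<longleftrightarrow> \<bar>fst c - fst d\<bar> + \<bar>snd c - snd d\<bar> = 1"

definition connected_cells :: "cell set \<Rightarrow> bool" where
  "connected_cells R \<longleftrightarrow>
     (\<forall>c\<in>R. \<forall>d\<in>R. (c, d) \<in> {(u, v). u \<in> R \<and> v \<in> R \<and> adjacent u v}\<^sup>*)"

definition polyomino :: "cell set \<Rightarrow> bool" where
  "polyomino R \<longleftrightarrow> finite R \<and> R \<noteq> {} \<and> connected_cells R"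

definition domino :: "cell set" where
  "domino = {(0, 0), (1, 0)}"

definition L_tile :: "cell set" where
  "L_tile = {(0, 0), (1, 0), (0, 1)}"

definition three_bar :: "cell set" where
  "three_bar = {(0, 0), (1, 0), (2, 0)}"

definition T_tile :: "cell set" where
  "T_tile = {(0, 0), (1, 0), (2, 0), (1, 1)}"

definition S_a :: "cell set set" where
  "S_a = {domino, L_tile, three_bar, T_tile}"

text \<open>The quarter turn acts on the names of the squares.  The geometric quarter turn about a
  lattice point moves the square named \<open>(x, y)\<close> to the one named \<open>(- y - 1, x)\<close>; the two
  differ by a translation, so both generate the same copies.\<close>

definition rot90 :: "cell \<Rightarrow> cell" where
  "rot90 c = (- snd c, fst c)"

definition translate :: "cell \<Rightarrow> cell \<Rightarrow> cell" where
  "translate v c = (fst v + fst c, snd v + snd c)"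

definition is_copy :: "cell set \<Rightarrow> cell set \<Rightarrow> bool" where
  "is_copy T Q \<longleftrightarrow> (\<exists>k v. Q = translate v ` (rot90 ^^ k) ` T)"

definition tileable :: "cell set set \<Rightarrow> cell set \<Rightarrow> bool" where
  "tileable S R \<longleftrightarrow>
     (\<exists>P. (\<forall>Q\<in>P. \<exists>T\<in>S. is_copy T Q) \<and> disjoint P \<and> \<Union>P = R)"


section \<open>Algorithms and running time\<close>

text \<open>Algorithms are structured programs for the random access machine: integer registers, of
  which a program mentions only finitely many, and an integer-addressed memory of integers.
  Every instruction and every test takes one time unit.  Addition and subtraction are the only
  arithmetic operations: they lengthen the numbers by at most one bit per step, so
  this uniform cost measure is polynomially related to Turing machine time.  (With unit-cost
  multiplication it would not be.)\<close>

type_synonym state = "(nat \<Rightarrow> int) \<times> (int \<Rightarrow> int)"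

datatype program =
    Skip
  | Const nat int
  | Add nat nat nat
  | Sub nat nat nat
  | Load nat nat
  | Store nat nat
  | Seq program program
  | IfPos nat program program
  | WhilePos nat program

text \<open>\<open>exec c s t s'\<close>: started in state \<open>s\<close>, the program \<open>c\<close> halts in state \<open>s'\<close> after exactly
  \<open>t\<close> time units.  A diverging run is related to no \<open>t\<close> and \<open>s'\<close>.\<close>

inductive exec :: "program \<Rightarrow> state \<Rightarrow> nat \<Rightarrow> state \<Rightarrow> bool" where
  exec_Skip: "exec Skip s 1 s"
| exec_Const: "exec (Const i k) (r, m) 1 (r(i := k), m)"
| exec_Add: "exec (Add i j l) (r, m) 1 (r(i := r j + r l), m)"
| exec_Sub: "exec (Sub i j l) (r, m) 1 (r(i := r j - r l), m)"
| exec_Load: "exec (Load i j) (r, m) 1 (r(i := m (r j)), m)"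
| exec_Store: "exec (Store i j) (r, m) 1 (r, m(r i := r j))"
| exec_Seq: "exec c s t s' \<Longrightarrow> exec d s' u s'' \<Longrightarrow> exec (Seq c d) s (t + u) s''"
| exec_IfTrue: "fst s i > 0 \<Longrightarrow> exec c s t s' \<Longrightarrow> exec (IfPos i c d) s (1 + t) s'"
| exec_IfFalse: "\<not> fst s i > 0 \<Longrightarrow> exec d s t s' \<Longrightarrow> exec (IfPos i c d) s (1 + t) s'"
| exec_WhileFalse: "\<not> fst s i > 0 \<Longrightarrow> exec (WhilePos i c) s 1 s"
| exec_WhileTrue: "fst s i > 0 \<Longrightarrow> exec c s t s' \<Longrightarrow> exec (WhilePos i c) s' u s'' \<Longrightarrow>
    exec (WhilePos i c) s (1 + t + u) s''"

inductive_cases exec_SkipE: "exec Skip s t s'"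
inductive_cases exec_ConstE: "exec (Const i k) s t s'"
inductive_cases exec_AddE: "exec (Add i j l) s t s'"
inductive_cases exec_SubE: "exec (Sub i j l) s t s'"
inductive_cases exec_LoadE: "exec (Load i j) s t s'"
inductive_cases exec_StoreE: "exec (Store i j) s t s'"
inductive_cases exec_SeqE: "exec (Seq c d) s t s'"
inductive_cases exec_IfPosE: "exec (IfPos i c d) s t s'"
inductive_cases exec_WhilePosE: "exec (WhilePos i c) s t s'"

lemma exec_deterministic:
  "exec c s t s' \<Longrightarrow> exec c s u s'' \<Longrightarrow> u = t \<and> s'' = s'"
proof (induction arbitrary: u s'' rule: exec.induct)
  case exec_Skip
  then show ?case by (rule exec_SkipE) simp
next
  case exec_Const
  then show ?case by (rule exec_ConstE) simp
next
  case exec_Add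
  then show ?case by (rule exec_AddE) simp
next
  case exec_Sub
  then show ?case by (rule exec_SubE) simp
next
  case exec_Load
  then show ?case by (rule exec_LoadE) simp
next
  case exec_Store
  then show ?case by (rule exec_StoreE) simp
next
  case exec_Seq
  from exec_Seq.prems show ?case
    by (rule exec_SeqE) (metis exec_Seq.IH)
next
  case exec_IfTrue
  from exec_IfTrue.prems show ?case
    by (rule exec_IfPosE) (metis exec_IfTrue.hyps(1) exec_IfTrue.IH plus_1_eq_Suc)+
next
  case exec_IfFalse
  from exec_IfFalse.prems show ?case
    by (rule exec_IfPosE) (metis exec_IfFalse.hyps(1) exec_IfFalse.IH plus_1_eq_Suc)+
next
  case exec_WhileFalse
  from exec_WhileFalse.prems show ?case
    by (rule exec_WhilePosE) (use exec_WhileFalse.hyps in simp_all)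
next
  case exec_WhileTrue
  from exec_WhileTrue.prems show ?case
    by (rule exec_WhilePosE) (metis exec_WhileTrue.hyps(1) exec_WhileTrue.IH plus_1_eq_Suc add_Suc)+
qed

text \<open>A finite set of squares is presented to a program as a listing of its elements: the memory
  holds the number \<open>n\<close> of squares at address 0, followed by the \<open>2 n\<close> coordinates.  All other
  memory entries, and all registers, are initially 0.\<close>

definition encode :: "cell list \<Rightarrow> int list" where
  "encode cs = int (length cs) # concat (map (\<lambda>(x, y). [x, y]) cs)"

definition initial_state :: "int list \<Rightarrow> state" where
  "initial_state w = ((\<lambda>_. 0), (\<lambda>a. if 0 \<le> a \<and> a < int (length w) then w ! nat a else 0))"

text \<open>The answer of a program is read off from register 0: 1 for yes and 0 for no.\<close>

definition answers_within :: "program \<Rightarrow> int list \<Rightarrow> nat \<Rightarrow> bool \<Rightarrow> bool" where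
  "answers_within c w b ans \<longleftrightarrow>
     (\<exists>t s. exec c (initial_state w) t s \<and> t \<le> b \<and> fst s 0 = (if ans then 1 else 0))"

text \<open>A program deciding \<open>Q\<close> has to be correct, within the time bound, for every order in which
  the squares of the polyomino may be listed.\<close>

definition decides_in_time :: "program \<Rightarrow> (cell set \<Rightarrow> bool) \<Rightarrow> (nat \<Rightarrow> nat) \<Rightarrow> bool" where
  "decides_in_time c Q f \<longleftrightarrow>
     (\<forall>R cs. polyomino R \<and> distinct cs \<and> set cs = R \<longrightarrow>
        answers_within c (encode cs) (f (card R)) (Q R))"

end

theory Submission
  imports Defs
begin

text \<open>The four tiles are exactly the stars of the grid graph with one, two or three leaves.  A tiled
  region contains at most three times as many squares of one checkerboard colour as of the other.
  For a connected region this suffices: if a packing of maximal size leaves a square \<open>u\<close>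
  uncovered, every neighbour of \<open>u\<close> is the centre of a T-tile of the packing, since otherwise
  \<open>u\<close> could be covered as well; turning that T-tile moves the hole to any of the other
  neighbours of the centre.  By connectedness every square coloured unlike \<open>u\<close> is the centre of
  a T-tile, so the colour of \<open>u\<close> has more than three times as many squares as the other one.
  Hence an algorithm only has to count colours.\<close>

section \<open>Tiles as stars of the grid graph\<close>

definition nbrs :: "cell \<Rightarrow> cell set" where
  "nbrs c = {d. adjacent c d}"

definition black :: "cell \<Rightarrow> bool" where
  "black c \<longleftrightarrow> even (fst c + snd c)"

text \<open>The number of leaves tells the tiles apart: one leaf gives a domino, two an L-tile or a
  3-bar, three a T-tile. Four leaves would give the plus pentomino, which is not in
  \<open>S_a\<close>.\<close>

definition star :: "cell set \<Rightarrow> bool" where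
  "star Q \<longleftrightarrow> (\<exists>c L. Q = insert c L \<and> L \<subseteq> nbrs c \<and> L \<noteq> {} \<and> card L \<le> 3)"

lemma adjacent_sym: "adjacent c d \<longleftrightarrow> adjacent d c"
  by (auto simp: adjacent_def abs_minus_commute)

lemma nbrs_sym: "c \<in> nbrs d \<longleftrightarrow> d \<in> nbrs c"
  by (simp add: nbrs_def adjacent_sym)

lemma abs_sum_eq_1: "\<bar>a::int\<bar> + \<bar>b\<bar> = 1 \<longleftrightarrow> (a = 1 \<and> b = 0) \<or> (a = -1 \<and> b = 0) \<or> (a = 0 \<and> b = 1) \<or> (a = 0 \<and> b = -1)"
  by linarith

lemma nbrs_eq: "nbrs (x, y) = {(x + 1, y), (x - 1, y), (x, y + 1), (x, y - 1)}"
  by (auto simp: nbrs_def adjacent_def abs_sum_eq_1)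

lemma finite_nbrs [simp]: "finite (nbrs c)"
  by (cases c) (simp add: nbrs_eq)

lemma finite_leaves: "L \<subseteq> nbrs c \<Longrightarrow> finite L"
  by (rule finite_subset[OF _ finite_nbrs])

lemma card_nbrs: "card (nbrs c) = 4"
  by (cases c) (simp add: nbrs_eq)

lemma not_in_nbrs [simp]: "c \<notin> nbrs c"
  by (simp add: nbrs_def adjacent_def)

lemma adjacent_black:
  assumes "adjacent c d"
  shows "black d \<longleftrightarrow> \<not> black c"
proof -
  have "fst d + snd d = fst c + snd c + 1 \<or> fst c + snd c = fst d + snd d + 1"
    using assms unfolding adjacent_def by linarith
  then show ?thesis unfolding black_def by (elim disjE) simp_all
qed

lemma nbrs_black: "d \<in> nbrs c \<Longrightarrow> black d \<longleftrightarrow> \<not> black c"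
  unfolding nbrs_def mem_Collect_eq by (rule adjacent_black)

section \<open>Copies of tiles are the same as stars\<close>

lemma star_rot90:
  assumes "star Q"
  shows "star (rot90 ` Q)"
proof -
  obtain c L where cL: "Q = insert c L" "L \<subseteq> nbrs c" "L \<noteq> {}" "card L \<le> 3"
    using assms unfolding star_def by blast
  have "rot90 ` L \<subseteq> nbrs (rot90 c)"
    using cL(2) by (auto simp: nbrs_def adjacent_def rot90_def)
  moreover have "card (rot90 ` L) \<le> 3"
    using cL(4) card_image_le[OF finite_leaves[OF cL(2)], of rot90] by simp
  ultimately show ?thesis
    unfolding star_def using cL by (intro exI[of _ "rot90 c"] exI[of _ "rot90 ` L"]) auto
qed

lemma star_translate:
  assumes "star Q"
  shows "star (translate v ` Q)"
proof -
  obtain c L where cL: "Q = insert c L" "L \<subseteq> nbrs c" "L \<noteq> {}" "card L \<le> 3"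
    using assms unfolding star_def by blast
  have "translate v ` L \<subseteq> nbrs (translate v c)"
    using cL(2) by (auto simp: nbrs_def adjacent_def translate_def)
  moreover have "card (translate v ` L) \<le> 3"
    using cL(4) card_image_le[OF finite_leaves[OF cL(2)], of "translate v"] by simp
  ultimately show ?thesis
    unfolding star_def using cL
    by (intro exI[of _ "translate v c"] exI[of _ "translate v ` L"]) auto
qed

lemma star_S_a:
  assumes "T \<in> S_a"
  shows "star T"
proof -
  have "star domino"
    unfolding star_def domino_def
    by (intro exI[of _ "(0,0)"] exI[of _ "{(1,0)}"]) (simp add: nbrs_eq)
  moreover have "star L_tile"
    unfolding star_def L_tile_def
    by (intro exI[of _ "(0,0)"] exI[of _ "{(1,0),(0,1)}"]) (simp add: nbrs_eq)
  moreover have "star three_bar"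
    unfolding star_def three_bar_def
    by (intro exI[of _ "(1,0)"] exI[of _ "{(0,0),(2,0)}"]) (auto simp add: nbrs_eq)
  moreover have "star T_tile"
    unfolding star_def T_tile_def
    by (intro exI[of _ "(1,0)"] exI[of _ "{(0,0),(2,0),(1,1)}"]) (auto simp add: nbrs_eq)
  ultimately show ?thesis
    using assms by (auto simp: S_a_def)
qed

lemma star_copy:
  assumes "T \<in> S_a" and "is_copy T Q"
  shows "star Q"
proof -
  obtain k v where Q: "Q = translate v ` (rot90 ^^ k) ` T"
    using assms(2) unfolding is_copy_def by blast
  have "star ((rot90 ^^ k) ` T)"
  proof (induction k)
    case 0
    then show ?case using star_S_a[OF assms(1)] by simp
  next
    case (Suc k)
    then show ?case using star_rot90[of "(rot90 ^^ k) ` T"] by (simp add: image_comp)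
  qed
  then show ?thesis
    unfolding Q by (rule star_translate)
qed

lemma subset_of_4_cases:
  assumes "L \<subseteq> {a, b, c, d}" "L \<noteq> {}" "L \<noteq> {a, b, c, d}"
  shows "L \<in> {{a}, {b}, {c}, {d}, {a,b}, {a,c}, {a,d}, {b,c}, {b,d}, {c,d},
    {a,b,c}, {a,b,d}, {a,c,d}, {b,c,d}}"
proof -
  have "L \<in> Pow {a, b, c, d}" using assms by simp
  then show ?thesis
    using assms(2,3)
    unfolding Pow_insert Pow_empty image_insert image_empty Un_insert_left Un_insert_right
      Un_empty_left Un_empty_right insert_iff empty_iff
    by argo
qed

lemma copy_witness:
  "Q = translate v ` (rot90 ^^ k) ` T \<Longrightarrow> T \<in> S_a \<Longrightarrow> \<exists>T\<in>S_a. is_copy T Q"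
  unfolding is_copy_def by blast

text \<open>Around a fixed centre there are fourteen stars, one for each nonempty proper subset of
  the four neighbours; each is exhibited as an explicitly turned and shifted tile.\<close>

lemma copy_star:
  assumes "star Q"
  shows "\<exists>T\<in>S_a. is_copy T Q"
proof -
  obtain c L where cL: "Q = insert c L" "L \<subseteq> nbrs c" "L \<noteq> {}" "card L \<le> 3"
    using assms unfolding star_def by blast
  obtain x y where c: "c = (x, y)" by (cases c)
  have "L \<noteq> nbrs c" using cL(4) card_nbrs[of c] by auto
  then have L: "L \<in> {{(x+1,y)}, {(x-1,y)}, {(x,y+1)}, {(x,y-1)},
      {(x+1,y),(x-1,y)}, {(x+1,y),(x,y+1)}, {(x+1,y),(x,y-1)},
      {(x-1,y),(x,y+1)}, {(x-1,y),(x,y-1)}, {(x,y+1),(x,y-1)},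
      {(x+1,y),(x-1,y),(x,y+1)}, {(x+1,y),(x-1,y),(x,y-1)},
      {(x+1,y),(x,y+1),(x,y-1)}, {(x-1,y),(x,y+1),(x,y-1)}}"
    using cL(2,3) unfolding c nbrs_eq by (intro subset_of_4_cases)
  note defs = translate_def rot90_def S_a_def domino_def L_tile_def three_bar_def T_tile_def
    numeral_2_eq_2 numeral_3_eq_3
  have S: "domino \<in> S_a" "L_tile \<in> S_a" "three_bar \<in> S_a" "T_tile \<in> S_a"
    by (simp_all add: S_a_def)
  \<comment> \<open>\<open>k\<close> counts quarter turns and \<open>v\<close> places the centre:
    the L-tile has its centre at the origin, whereas the 3-bar and the T-tile have theirs at
    \<open>(1,0)\<close>, so for them \<open>v\<close> is \<open>c\<close> minus the turned
    \<open>(1,0)\<close>.\<close>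
  show ?thesis
    using L unfolding cL(1) c insert_iff empty_iff
  proof (elim disjE FalseE, goal_cases)
    case 1 then show ?case
      by (intro copy_witness[OF _ S(1), where k = 0 and v = "(x,y)"]) (auto simp: defs)
  next
    case 2 then show ?case
      by (intro copy_witness[OF _ S(1), where k = 0 and v = "(x-1,y)"]) (auto simp: defs)
  next
    case 3 then show ?case
      by (intro copy_witness[OF _ S(1), where k = 1 and v = "(x,y)"]) (auto simp: defs)
  next
    case 4 then show ?case
      by (intro copy_witness[OF _ S(1), where k = 1 and v = "(x,y-1)"]) (auto simp: defs)
  next
    case 5 then show ?case
      by (intro copy_witness[OF _ S(3), where k = 0 and v = "(x-1,y)"]) (auto simp: defs)
  next
    case 6 then show ?case
      by (intro copy_witness[OF _ S(2), where k = 0 and v = "(x,y)"]) (auto simp: defs)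
  next
    case 7 then show ?case
      by (intro copy_witness[OF _ S(2), where k = 3 and v = "(x,y)"]) (auto simp: defs)
  next
    case 8 then show ?case
      by (intro copy_witness[OF _ S(2), where k = 1 and v = "(x,y)"]) (auto simp: defs)
  next
    case 9 then show ?case
      by (intro copy_witness[OF _ S(2), where k = 2 and v = "(x,y)"]) (auto simp: defs)
  next
    case 10 then show ?case
      by (intro copy_witness[OF _ S(3), where k = 1 and v = "(x,y-1)"]) (auto simp: defs)
  next
    case 11 then show ?case
      by (intro copy_witness[OF _ S(4), where k = 0 and v = "(x-1,y)"]) (auto simp: defs)
  next
    case 12 then show ?case
      by (intro copy_witness[OF _ S(4), where k = 2 and v = "(x+1,y)"]) (auto simp: defs)
  next
    case 13 then show ?case
      by (intro copy_witness[OF _ S(4), where k = 3 and v = "(x,y+1)"]) (auto simp: defs)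
  next
    case 14 then show ?case
      by (intro copy_witness[OF _ S(4), where k = 1 and v = "(x,y-1)"]) (auto simp: defs)
  qed
qed

text \<open>Partial tilings: squares of \<open>R\<close> may stay uncovered, so that every region
  has packings and one of maximal coverage can be studied.\<close>

definition packing :: "cell set \<Rightarrow> cell set set \<Rightarrow> bool" where
  "packing R P \<longleftrightarrow> (\<forall>Q\<in>P. star Q) \<and> disjoint P \<and> \<Union>P \<subseteq> R"

lemma tileable_S_a_iff: "tileable S_a R \<longleftrightarrow> (\<exists>P. packing R P \<and> \<Union>P = R)"
proof -
  have "(\<exists>T\<in>S_a. is_copy T Q) \<longleftrightarrow> star Q" for Q
  proof
    assume "\<exists>T\<in>S_a. is_copy T Q"
    then show "star Q" by (elim bexE) (rule star_copy)
  qed (rule copy_star)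
  then show ?thesis
    unfolding tileable_def packing_def by (intro iff_exI) (simp cong: conj_cong, blast)
qed

section \<open>Colour balance decides tileability\<close>

text \<open>All leaves have the colour opposite to the centre, and there are between one and three
  of them. Leaving \<open>b\<close> free gives the inequality in both directions.\<close>

lemma star_balance:
  assumes "star Q"
  shows "finite Q" and "card {c \<in> Q. black c = b} \<le> 3 * card {c \<in> Q. black c \<noteq> b}"
proof -
  obtain c L where cL: "Q = insert c L" "L \<subseteq> nbrs c" "L \<noteq> {}" "card L \<le> 3"
    using assms unfolding star_def by blast
  have fin: "finite L" using cL(2) by (rule finite_leaves)
  then show "finite Q" using cL by simp
  have col: "black d \<longleftrightarrow> \<not> black c" if "d \<in> L" for d
    using that cL(2) nbrs_black by blast
  have pos: "0 < card L" using fin cL(3) by (simp add: card_gt_0_iff)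
  show "card {c \<in> Q. black c = b} \<le> 3 * card {c \<in> Q. black c \<noteq> b}"
  proof (cases "black c = b")
    case True
    then have "{c \<in> Q. black c = b} = {c}" "{c \<in> Q. black c \<noteq> b} = L"
      using col cL(1) by auto
    then show ?thesis using pos by simp
  next
    case False
    then have "{c \<in> Q. black c = b} = L" "{c \<in> Q. black c \<noteq> b} = {c}"
      using col cL(1) by auto
    then show ?thesis using cL(4) by simp
  qed
qed

text \<open>Both colour counts are sums over the disjoint tiles, so the bound for a single star adds
  up.\<close>

lemma tileable_imp_balanced:
  assumes "finite R" "packing R P" "\<Union>P = R"
  shows "card {c \<in> R. black c = b} \<le> 3 * card {c \<in> R. black c \<noteq> b}"
proof -
  have finP: "finite P"
    using assms(1,3) by (metis finite_UnionD)
  have disj: "disjoint P" and star: "\<And>Q. Q \<in> P \<Longrightarrow> star Q"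
    using assms(2) by (auto simp: packing_def)
  have split: "card {c \<in> R. \<phi> c} = (\<Sum>Q\<in>P. card {c \<in> Q. \<phi> c})" for \<phi>
  proof -
    have "{c \<in> R. \<phi> c} = (\<Union>Q\<in>P. {c \<in> Q. \<phi> c})" using assms(3) by auto
    moreover have "\<forall>Q\<in>P. finite {c \<in> Q. \<phi> c}" using star star_balance(1) by simp
    moreover have "\<forall>Q\<in>P. \<forall>Q'\<in>P. Q \<noteq> Q' \<longrightarrow> {c \<in> Q. \<phi> c} \<inter> {c \<in> Q'. \<phi> c} = {}"
      using disjointD[OF disj] by blast
    ultimately show ?thesis using finP by (simp add: card_UN_disjoint)
  qed
  show ?thesis
    unfolding split sum_distrib_left by (intro sum_mono star_balance(2) star)
qed

section \<open>Exchanging tiles of a packing\<close>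

lemma packing_replace:
  assumes "packing R P" "P0 \<subseteq> P" "packing R N" "\<Union>N \<subseteq> \<Union>P0 \<union> (R - \<Union>P)"
  shows "packing R (P - P0 \<union> N)"
proof -
  have disj: "disjoint P" "disjoint N" using assms by (auto simp: packing_def)
  \<comment> \<open>A square of a new tile lies either in a removed tile, which is disjoint from
    every kept one, or outside the old cover.\<close>
  have "\<Union>(P - P0) \<inter> \<Union>N = {}"
  proof (rule ccontr)
    assume "\<not> ?thesis"
    then obtain x Q where x: "x \<in> Q" "Q \<in> P" "Q \<notin> P0" "x \<in> \<Union>N" by blast
    then obtain Q0 where Q0: "Q0 \<in> P0" "x \<in> Q0" using assms(4) by blast
    have "Q \<inter> Q0 = {}"
    proof (rule disjointD[OF disj(1) x(2)])
      show "Q0 \<in> P" using Q0(1) assms(2) by (rule subsetD[rotated])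
      show "Q \<noteq> Q0" using x(3) Q0(1) by blast
    qed
    then show False using x(1) Q0(2) by blast
  qed
  then have "disjoint (P - P0 \<union> N)"
    using disj by (intro disjoint_union) (auto simp: disjoint_def)
  then show ?thesis using assms by (auto simp: packing_def)
qed

text \<open>The centres of full stars, which cannot take a further leaf; they are the only obstacle
  to growing a packing next to a hole.\<close>

definition T_centres :: "cell set set \<Rightarrow> cell set" where
  "T_centres P = {c. \<exists>L. insert c L \<in> P \<and> L \<subseteq> nbrs c \<and> card L = 3}"

text \<open>Four situations at \<open>w\<close>: if uncovered, it forms a domino with
  \<open>u\<close>; as a centre with fewer than three leaves, it takes \<open>u\<close> as a new
  leaf; as the only leaf of a domino, it becomes the centre and takes \<open>u\<close>; as one of
  several leaves, it is cut off and paired with \<open>u\<close>.\<close>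

lemma packing_augment:
  assumes "packing R P" "u \<in> R - \<Union>P" "w \<in> R" "adjacent u w" "w \<notin> T_centres P"
  shows "\<exists>P'. packing R P' \<and> \<Union>P \<subset> \<Union>P'"
proof -
  have uw: "u \<in> nbrs w" "w \<in> nbrs u" "u \<noteq> w"
    using assms(4) adjacent_sym by (auto simp: nbrs_def adjacent_def)
  have star_uw: "star {w, u}"
    unfolding star_def using uw by (intro exI[of _ w] exI[of _ "{u}"]) auto
  show ?thesis
  proof (cases "w \<in> \<Union>P")
    case False
    have "packing R {{w, u}}" using star_uw assms(2,3) by (simp add: packing_def)
    from packing_replace[OF assms(1) _ this, of "{}"]
    have "packing R (P \<union> {{w, u}})" using assms(2,3) False by simp
    moreover have "\<Union>P \<subset> \<Union>(P \<union> {{w, u}})" using assms(2) by auto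
    ultimately show ?thesis by blast
  next
    case True
    then obtain Q where Q: "Q \<in> P" "w \<in> Q" by blast
    have "star Q" "Q \<subseteq> R" using assms(1) Q by (auto simp: packing_def)
    then obtain c L where cL: "Q = insert c L" "L \<subseteq> nbrs c" "L \<noteq> {}" "card L \<le> 3"
      unfolding star_def by blast
    have finL: "finite L" using cL(2) by (rule finite_leaves)
    have uQ: "u \<notin> Q" using assms(2) Q by blast
    \<comment> \<open>Stated for an arbitrary leaf set \<open>M\<close>, because a domino can be
      read with either square as its centre.\<close>
    have central: ?thesis if L: "Q = insert w M" "M \<subseteq> nbrs w" "card M < 3" for M
    proof -
      have "finite M" using L(2) by (rule finite_leaves)
      then have "card (insert u M) \<le> 3" using L(3) by (simp add: card_insert_if)
      then have "star (insert u Q)"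
        unfolding star_def using L uw
        by (intro exI[of _ w] exI[of _ "insert u M"]) auto
      then have N: "packing R {insert u Q}"
        using \<open>Q \<subseteq> R\<close> assms(2) by (simp add: packing_def)
      have "packing R (P - {Q} \<union> {insert u Q})"
        by (rule packing_replace[OF assms(1) _ N]) (use Q assms(2) in auto)
      moreover have "\<Union>P \<subset> \<Union>(P - {Q} \<union> {insert u Q})" using assms(2) by auto
      ultimately show ?thesis by blast
    qed
    show ?thesis
    proof (cases "w = c")
      case True
      then have "card L \<noteq> 3" using assms(5) cL Q by (auto simp: T_centres_def)
      then show ?thesis using central[of L] cL True by simp
    next
      case False
      then have wL: "w \<in> L" using Q cL by simp
      have wc: "c \<in> nbrs w" using wL cL(2) nbrs_sym by blast
      show ?thesis
      proof (cases "L = {w}")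
        case True
        then show ?thesis using central[of "{c}"] cL wc by auto
      next
        case False
        have "L - {w} \<noteq> {}" using False wL by blast
        moreover have "card (L - {w}) \<le> 3" using cL(4) by (simp add: finL wL)
        moreover have "Q - {w} = insert c (L - {w})" using cL \<open>w \<noteq> c\<close> by auto
        ultimately have "star (Q - {w})"
          unfolding star_def using cL(2) by (intro exI[of _ c] exI[of _ "L - {w}"]) auto
        then have N: "packing R {Q - {w}, {w, u}}"
          using star_uw assms(2,3) \<open>Q \<subseteq> R\<close> uQ by (auto simp: packing_def disjoint_def)
        have "packing R (P - {Q} \<union> {Q - {w}, {w, u}})"
          by (rule packing_replace[OF assms(1) _ N]) (use Q assms(2) in auto)
        moreover have "\<Union>P \<subset> \<Union>(P - {Q} \<union> {Q - {w}, {w, u}})"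
          using assms(2) Q by auto
        ultimately show ?thesis by blast
      qed
    qed
  qed
qed

text \<open>Two candidate centres would be adjacent, hence of opposite colours. Every leaf of
  \<open>c\<close> then has the colour of \<open>d\<close> while lying in the star of
  \<open>d\<close>, so it is \<open>d\<close> itself, which leaves no room for three leaves.\<close>

lemma T_centre_unique:
  assumes "insert c L = insert d M" "L \<subseteq> nbrs c" "M \<subseteq> nbrs d" "card L = 3"
  shows "c = d"
proof (rule ccontr)
  assume "c \<noteq> d"
  have "c \<in> insert d M" and "L \<subseteq> insert d M"
    using assms(1) by blast+
  then have c: "c \<in> nbrs d"
    using \<open>c \<noteq> d\<close> assms(3) by blast
  have "L \<subseteq> {d}"
  proof
    fix x assume x: "x \<in> L"
    then have "black x \<noteq> black c" using assms(2) nbrs_black by blast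
    moreover have "black c \<noteq> black d" using c nbrs_black by blast
    moreover have "x = d \<or> black x \<noteq> black d"
      using x \<open>L \<subseteq> insert d M\<close> assms(3) nbrs_black by blast
    ultimately show "x \<in> {d}" by blast
  qed
  then have "card L \<le> 1" using card_mono[of "{d}" L] by simp
  then show False using assms(4) by simp
qed

text \<open>Sliding a T-tile at \<open>w\<close> onto the uncovered square \<open>u\<close> uncovers any other neighbour of
  \<open>w\<close> and changes no centre.\<close>

lemma packing_swap:
  assumes "packing R P" "u \<in> R - \<Union>P" "adjacent u w" "w \<in> T_centres P"
    and "adjacent w u'" "u' \<noteq> u"
  shows "\<exists>P'. packing R P' \<and> \<Union>P' = insert u (\<Union>P - {u'}) \<and> u' \<in> \<Union>P \<and>
    T_centres P' \<subseteq> T_centres P"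
proof -
  obtain L where L: "insert w L \<in> P" "L \<subseteq> nbrs w" "card L = 3"
    using assms(4) by (auto simp: T_centres_def)
  have finL: "finite L" using L(2) by (rule finite_leaves)
  have LR: "insert w L \<subseteq> R" using L assms(1) by (auto simp: packing_def)
  have u: "u \<in> nbrs w" "u' \<in> nbrs w" "u \<noteq> w" "u' \<noteq> w"
    using assms(3,5) adjacent_sym by (auto simp: nbrs_def adjacent_def)
  have uL: "u \<notin> L" using assms(2) L(1) by blast
  \<comment> \<open>\<open>u\<close> and the three leaves exhaust the four neighbours of
    \<open>w\<close>; hence \<open>u'\<close> is a leaf.\<close>
  have "card (insert u L) = card (nbrs w)" using uL L(3) finL by (simp add: card_nbrs)
  then have "insert u L = nbrs w" using L(2) u(1) by (intro card_subset_eq) auto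
  then have u'L: "u' \<in> L" using u(2) assms(6) by blast
  define M where "M = insert u (L - {u'})"
  have M: "M \<subseteq> nbrs w" "card M = 3" "finite M" "M \<noteq> {}"
    using L finL u uL u'L by (auto simp: M_def)
  have "star (insert w M)" unfolding star_def using M by (intro exI[of _ w] exI[of _ M]) auto
  then have N: "packing R {insert w M}"
    using LR assms(2) by (auto simp: packing_def M_def)
  let ?P = "P - {insert w L} \<union> {insert w M}"
  have "packing R ?P"
    by (rule packing_replace[OF assms(1) _ N]) (use L assms(2) in \<open>auto simp: M_def\<close>)
  moreover have "\<Union>?P = insert u (\<Union>P - {u'})"
  proof -
    have "disjoint P" using assms(1) by (simp add: packing_def)
    \<comment> \<open>By disjointness \<open>u'\<close> belongs to the old T-tile alone, so no kept
      tile still covers it.\<close>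
    then have "u' \<notin> Q" if "Q \<in> P" "Q \<noteq> insert w L" for Q
      using disjointD[OF _ that(1) L(1) that(2)] u'L by blast
    then have "\<Union>(P - {insert w L}) = \<Union>(P - {insert w L}) - {u'}" by blast
    moreover have "\<Union>P = \<Union>(P - {insert w L}) \<union> insert w L" using L(1) by blast
    ultimately show ?thesis
      using u(4) assms(6) unfolding M_def by auto
  qed
  moreover have "T_centres ?P \<subseteq> T_centres P"
  proof
    fix c assume "c \<in> T_centres ?P"
    then obtain K where K: "insert c K \<in> ?P" "K \<subseteq> nbrs c" "card K = 3"
      by (auto simp: T_centres_def)
    show "c \<in> T_centres P"
    proof (cases "insert c K \<in> P")
      case True
      then show ?thesis using K by (auto simp: T_centres_def)
    next
      case False
      then have "insert c K = insert w M" using K(1) by blast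
      \<comment> \<open>A star with three leaves has only one centre, so the new tile contributes no
        centre other than \<open>w\<close>.\<close>
      then have "c = w" using T_centre_unique[of c K w M] K M by blast
      then show ?thesis using assms(4) by simp
    qed
  qed
  moreover have "u' \<in> \<Union>P" using L(1) u'L by blast
  ultimately show ?thesis by blast
qed

section \<open>Balanced connected regions have a tiling\<close>

lemma balanced_imp_tileable:
  assumes "finite R" "connected_cells R"
    and balanced: "\<And>b. card {c \<in> R. black c = b} \<le> 3 * card {c \<in> R. black c \<noteq> b}"
  shows "\<exists>P. packing R P \<and> \<Union>P = R"
proof (rule ccontr)
  assume contra: "\<not> ?thesis"
  \<comment> \<open>Maximality refers to the number of covered squares, not to the number of
    tiles.\<close>
  define M where "M = Max {card (\<Union>P) |P. packing R P}"
  have fin: "finite {card (\<Union>P) |P. packing R P}"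
  proof (rule finite_subset)
    show "{card (\<Union>P) |P. packing R P} \<subseteq> {..card R}"
      using assms(1) by (auto simp: packing_def intro: card_mono)
  qed simp
  have "packing R {}" by (simp add: packing_def)
  then have "{card (\<Union>P) |P. packing R P} \<noteq> {}" by blast
  from Max_in[OF fin this] obtain P0 where P0: "packing R P0" "card (\<Union>P0) = M"
    unfolding M_def by auto
  have maximal: "card (\<Union>P) \<le> M" if "packing R P" for P
    unfolding M_def using that by (intro Max_ge[OF fin]) blast
  have fin_cover: "finite (\<Union>P)" if "packing R P" for P
    using that assms(1) finite_subset unfolding packing_def by blast
  have "\<Union>P0 \<subseteq> R" "\<Union>P0 \<noteq> R"
    using contra P0(1) unfolding packing_def by blast+
  then obtain v where v: "v \<in> R" "v \<notin> \<Union>P0" by blast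
  \<comment> \<open>Squares that can be holes of a packing of maximal coverage. Tying the T-centres
    to those of \<open>P0\<close> lets all conclusions refer to the single packing
    \<open>P0\<close>, in which the final count takes place.\<close>
  define U where "U = {u \<in> R. \<exists>P. packing R P \<and> card (\<Union>P) = M \<and>
    T_centres P \<subseteq> T_centres P0 \<and> u \<notin> \<Union>P}"
  have vU: "v \<in> U" unfolding U_def using v P0 by blast
  have closed: "w \<in> T_centres P0 \<and> (\<forall>u'\<in>R. adjacent w u' \<longrightarrow> u' \<in> U)"
    if uw: "u \<in> U" "w \<in> R" "adjacent u w" for u w
  proof -
    obtain P where P: "u \<in> R" "packing R P" "card (\<Union>P) = M" "T_centres P \<subseteq> T_centres P0" "u \<notin> \<Union>P"
      using \<open>u \<in> U\<close> unfolding U_def by blast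
    have u: "u \<in> R - \<Union>P" using P(1,5) by (rule DiffI)
    have w: "w \<in> T_centres P"
    proof (rule ccontr)
      assume "w \<notin> T_centres P"
      from packing_augment[OF P(2) u uw(2,3) this]
      obtain P' where P': "packing R P'" "\<Union>P \<subset> \<Union>P'" by blast
      then have "M < card (\<Union>P')"
        using P(3) psubset_card_mono[OF fin_cover[OF P'(1)]] by metis
      then show False using maximal[OF P'(1)] by simp
    qed
    have "u' \<in> U" if u': "u' \<in> R" "adjacent w u'" for u'
    proof (cases "u' = u")
      case True
      then show ?thesis using \<open>u \<in> U\<close> by simp
    next
      case False
      from packing_swap[OF P(2) u uw(3) w u'(2) this]
      obtain P' where P': "packing R P'" "\<Union>P' = insert u (\<Union>P - {u'})" "u' \<in> \<Union>P"
          "T_centres P' \<subseteq> T_centres P"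
        by blast
      \<comment> \<open>The slide covers \<open>u\<close> and frees \<open>u'\<close>, so the
        coverage stays maximal.\<close>
      have "card (\<Union>P') = M"
        using P'(2,3) P(3,5) fin_cover[OF P(2)]
          card_Suc_Diff1[OF fin_cover[OF P(2)] P'(3)] by simp
      then show ?thesis
        unfolding U_def using u'(1) P'(1,2,4) P(4) False by blast
    qed
    then show ?thesis using w P by blast
  qed
  \<comment> \<open>The induction along a path alternates colours: squares coloured like
    \<open>v\<close> can be holes, the others are T-centres all of whose neighbours in
    \<open>R\<close> can be holes. Each half supplies the other at the next step.\<close>
  have reach: "if black c = black v then c \<in> U
      else c \<in> T_centres P0 \<and> (\<forall>u'\<in>R. adjacent c u' \<longrightarrow> u' \<in> U)"
    if "(v, c) \<in> {(u, w). u \<in> R \<and> w \<in> R \<and> adjacent u w}\<^sup>*" for c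
    using that
  proof (induction rule: rtrancl_induct)
    case base
    then show ?case using vU by simp
  next
    case (step c d)
    then have "d \<in> R" "adjacent c d" by auto
    then show ?case
      using step.IH closed[of c d]
        adjacent_black[of c d] by (auto split: if_splits)
  qed
  define X where "X = {c \<in> R. black c = black v}"
  define N where "N = {c \<in> R. black c \<noteq> black v}"
  have "N \<subseteq> T_centres P0"
  proof
    fix c assume "c \<in> N"
    then have "c \<in> R" "black c \<noteq> black v" by (auto simp: N_def)
    then show "c \<in> T_centres P0"
      using reach[of c] assms(2) v(1) unfolding connected_cells_def by auto
  qed
  then have "\<forall>w\<in>N. \<exists>L. insert w L \<in> P0 \<and> L \<subseteq> nbrs w \<and> card L = 3"
    by (auto simp: T_centres_def)
  then obtain leaves where leaves:
    "\<And>w. w \<in> N \<Longrightarrow> insert w (leaves w) \<in> P0"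
    "\<And>w. w \<in> N \<Longrightarrow> leaves w \<subseteq> nbrs w"
    "\<And>w. w \<in> N \<Longrightarrow> card (leaves w) = 3"
    by metis
  have finX: "finite X" and finN: "finite N" using assms(1) by (auto simp: X_def N_def)
  \<comment> \<open>Leaves of a centre coloured unlike \<open>v\<close> are coloured like
    \<open>v\<close>; being covered by \<open>P0\<close>, they avoid the hole
    \<open>v\<close>.\<close>
  have sub: "leaves w \<subseteq> X - {v}" if "w \<in> N" for w
  proof
    fix x assume x: "x \<in> leaves w"
    have "black x \<noteq> black w" using x leaves(2)[OF that] nbrs_black by blast
    moreover have "x \<in> \<Union>P0" using x leaves(1)[OF that] by blast
    moreover have "x \<in> R" using calculation P0(1) by (auto simp: packing_def)
    ultimately show "x \<in> X - {v}" using that v by (auto simp: X_def N_def)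
  qed
  have "card (\<Union>w\<in>N. leaves w) = (\<Sum>w\<in>N. card (leaves w))"
  proof (rule card_UN_disjoint[OF finN])
    show "\<forall>w\<in>N. finite (leaves w)" using leaves(2) finite_leaves by blast
    show "\<forall>w\<in>N. \<forall>w'\<in>N. w \<noteq> w' \<longrightarrow> leaves w \<inter> leaves w' = {}"
    proof (intro ballI impI)
      fix w w' assume ww: "w \<in> N" "w' \<in> N" "w \<noteq> w'"
      \<comment> \<open>All these leaves have the colour of \<open>v\<close>, so no centre is a leaf
        of another star, and distinct centres belong to distinct tiles.\<close>
      then have "w \<notin> insert w' (leaves w')"
        using sub[of w'] by (auto simp: X_def N_def)
      then have "insert w (leaves w) \<noteq> insert w' (leaves w')" by blast
      moreover have "disjoint P0" using P0(1) by (simp add: packing_def)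
      ultimately have "insert w (leaves w) \<inter> insert w' (leaves w') = {}"
        using disjointD leaves(1) ww(1,2) by metis
      then show "leaves w \<inter> leaves w' = {}" by blast
    qed
  qed
  also have "\<dots> = 3 * card N" using leaves(3) by simp
  finally have "3 * card N = card (\<Union>w\<in>N. leaves w)" by simp
  \<comment> \<open>Three private leaves per centre fit into \<open>X\<close> with \<open>v\<close>
    left over, so \<open>X\<close> has more than three times as many squares as
    \<open>N\<close>.\<close>
  also have "\<dots> \<le> card (X - {v})" using finX sub by (intro card_mono) auto
  also have "\<dots> < card X"
    using finX v(1) by (intro card_Diff1_less) (auto simp: X_def)
  finally show False using balanced[of "black v"] by (simp add: X_def N_def)
qed

section \<open>Balance as a bound on a signed count\<close>

definition cell_sign :: "cell \<Rightarrow> int" where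
  "cell_sign c = (if black c then 1 else -1)"

text \<open>\<open>a \<le> 3 * b\<close> rearranges to \<open>2 * (a - b) \<le> a + b\<close>. The
  two colour inequalities thus become one bound that additions and subtractions can
  evaluate.\<close>

lemma within_factor_3_iff:
  fixes a b :: nat
  shows "a \<le> 3 * b \<and> b \<le> 3 * a \<longleftrightarrow> \<bar>2 * (int a - int b)\<bar> \<le> int (a + b)"
proof -
  have "\<bar>2 * (x - y)\<bar> \<le> x + y \<longleftrightarrow> x \<le> 3 * y \<and> y \<le> 3 * x" for x y :: int
    unfolding abs_le_iff by (intro iffI conjI) simp_all
  from this[of "int a" "int b"] show ?thesis
    unfolding of_nat_add by (simp only: of_nat_le_iff[symmetric, where ?'a = int] of_nat_mult of_nat_numeral)
qed

text \<open>The absolute value makes the criterion insensitive to swapping the colours, so a program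
  needs the signs only up to a common factor.\<close>

lemma tileable_iff_sign_sum:
  assumes "polyomino R"
  shows "tileable S_a R \<longleftrightarrow> \<bar>2 * (\<Sum>c\<in>R. cell_sign c)\<bar> \<le> int (card R)"
proof -
  have R: "finite R" "connected_cells R" using assms by (auto simp: polyomino_def)
  define X where "X = {c \<in> R. black c}"
  define N where "N = {c \<in> R. \<not> black c}"
  have R_eq: "R = X \<union> N" "X \<inter> N = {}" "finite X" "finite N"
    using R(1) by (auto simp: X_def N_def)
  have card: "card R = card X + card N"
    using R_eq card_Un_disjoint by metis
  have "(\<Sum>c\<in>R. cell_sign c) = (\<Sum>c\<in>X. cell_sign c) + (\<Sum>c\<in>N. cell_sign c)"
    using R_eq sum.union_disjoint by metis
  also have "\<dots> = int (card X) - int (card N)"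
    by (simp add: X_def N_def cell_sign_def)
  finally have sum: "(\<Sum>c\<in>R. cell_sign c) = int (card X) - int (card N)" .
  have "tileable S_a R \<longleftrightarrow>
      (\<forall>b. card {c \<in> R. black c = b} \<le> 3 * card {c \<in> R. black c \<noteq> b})"
    unfolding tileable_S_a_iff
  proof (intro iffI allI)
    show "card {c \<in> R. black c = b} \<le> 3 * card {c \<in> R. black c \<noteq> b}"
      if "\<exists>P. packing R P \<and> \<Union>P = R" for b
      using that tileable_imp_balanced[OF R(1)] by blast
    show "\<exists>P. packing R P \<and> \<Union>P = R"
      if "\<forall>b. card {c \<in> R. black c = b} \<le> 3 * card {c \<in> R. black c \<noteq> b}"
      by (rule balanced_imp_tileable[OF R]) (rule spec[OF that])
  qed
  also have "\<dots> \<longleftrightarrow> card X \<le> 3 * card N \<and> card N \<le> 3 * card X"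
    by (simp add: all_bool_eq X_def N_def)
  also have "\<dots> \<longleftrightarrow> \<bar>2 * (\<Sum>c\<in>R. cell_sign c)\<bar> \<le> int (card R)"
    unfolding sum card by (rule within_factor_3_iff)
  finally show ?thesis .
qed

section \<open>The program\<close>

definition wp :: "program \<Rightarrow> (nat \<Rightarrow> state \<Rightarrow> bool) \<Rightarrow> state \<Rightarrow> bool" where
  "wp c \<Phi> s \<longleftrightarrow> (\<exists>t s'. exec c s t s' \<and> \<Phi> t s')"

lemma wp_mono: "wp c \<Phi> s \<Longrightarrow> (\<And>t s'. \<Phi> t s' \<Longrightarrow> \<Psi> t s') \<Longrightarrow> wp c \<Psi> s"
  unfolding wp_def by blast

text \<open>Keeps the simplifier from rewriting a continuation before its initial state is known.\<close>

lemma wp_weak_cong [cong]: "s = s' \<Longrightarrow> wp c \<Phi> s = wp c \<Phi> s'"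
  by simp

text \<open>\<open>wp\<close> only asserts that some run satisfies the postcondition; determinism
  makes this an equivalence once one run is known, so that \<open>wp\<close> can be computed by
  rewriting.\<close>

lemma wp_exec: "exec c s t s' \<Longrightarrow> wp c \<Phi> s \<longleftrightarrow> \<Phi> t s'"
  unfolding wp_def using exec_deterministic by metis

lemma wp_basic [simp]:
  "wp Skip \<Phi> s \<longleftrightarrow> \<Phi> 1 s"
  "wp (Const i k) \<Phi> (r, m) \<longleftrightarrow> \<Phi> 1 (r(i := k), m)"
  "wp (Add i j l) \<Phi> (r, m) \<longleftrightarrow> \<Phi> 1 (r(i := r j + r l), m)"
  "wp (Sub i j l) \<Phi> (r, m) \<longleftrightarrow> \<Phi> 1 (r(i := r j - r l), m)"
  "wp (Load i j) \<Phi> (r, m) \<longleftrightarrow> \<Phi> 1 (r(i := m (r j)), m)"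
  by (rule wp_exec exec_Skip exec_Const exec_Add exec_Sub exec_Load)+

lemma wp_Seq [simp]: "wp (Seq c d) \<Phi> s \<longleftrightarrow> wp c (\<lambda>t. wp d (\<lambda>u. \<Phi> (t + u))) s"
  unfolding wp_def by (blast intro: exec_Seq elim: exec_SeqE)

lemma wp_IfPos [simp]:
  "wp (IfPos i c d) \<Phi> s \<longleftrightarrow>
     (if fst s i > 0 then wp c (\<lambda>t. \<Phi> (1 + t)) s else wp d (\<lambda>t. \<Phi> (1 + t)) s)"
proof -
  have True_iff: "exec (IfPos i c d) s t s' \<longleftrightarrow> (\<exists>u. t = 1 + u \<and> exec c s u s')"
    if "fst s i > 0" for t s'
  proof
    assume "exec (IfPos i c d) s t s'"
    then show "\<exists>u. t = 1 + u \<and> exec c s u s'" by (rule exec_IfPosE) (use that in auto)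
  next
    assume "\<exists>u. t = 1 + u \<and> exec c s u s'"
    then obtain u where "t = 1 + u" "exec c s u s'" by (elim exE conjE)
    then show "exec (IfPos i c d) s t s'" using exec_IfTrue[OF that] by simp
  qed
  have False_iff: "exec (IfPos i c d) s t s' \<longleftrightarrow> (\<exists>u. t = 1 + u \<and> exec d s u s')"
    if "\<not> fst s i > 0" for t s'
  proof
    assume "exec (IfPos i c d) s t s'"
    then show "\<exists>u. t = 1 + u \<and> exec d s u s'" by (rule exec_IfPosE) (use that in auto)
  next
    assume "\<exists>u. t = 1 + u \<and> exec d s u s'"
    then obtain u where "t = 1 + u" "exec d s u s'" by (elim exE conjE)
    then show "exec (IfPos i c d) s t s'" using exec_IfFalse[OF that] by simp
  qed
  show ?thesis
  proof (cases "fst s i > 0")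
    case True
    then show ?thesis unfolding wp_def if_P[OF True] True_iff[OF True] by blast
  next
    case False
    then show ?thesis unfolding wp_def if_not_P[OF False] False_iff[OF False] by blast
  qed
qed

text \<open>The index of \<open>I\<close> is the number of rounds still to come. Each round costs
  its body and one test; the last summand 1 is the failing test.\<close>

lemma wp_while:
  assumes "\<And>k s. I (Suc k) s \<Longrightarrow> fst s i > 0 \<and> wp c (\<lambda>t s'. t \<le> B \<and> I k s') s"
    and "\<And>s. I 0 s \<Longrightarrow> \<not> fst s i > 0"
    and "I k s"
  shows "wp (WhilePos i c) (\<lambda>t s'. t \<le> k * (B + 1) + 1 \<and> I 0 s') s"
  using assms(3)
proof (induction k arbitrary: s)
  case 0
  then show ?case
    using wp_exec[OF exec_WhileFalse[OF assms(2)[OF 0]]] by simp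
next
  case (Suc k)
  from assms(1)[OF Suc.prems] obtain t s' where
    s': "fst s i > 0" "exec c s t s'" "t \<le> B" "I k s'"
    unfolding wp_def by blast
  from Suc.IH[OF s'(4)] obtain u s'' where
    s'': "exec (WhilePos i c) s' u s''" "u \<le> k * (B + 1) + 1" "I 0 s''"
    unfolding wp_def by blast
  have "1 + t + u \<le> Suc k * (B + 1) + 1" using s'(3) s''(2) by simp
  then show ?case
    unfolding wp_def using exec_WhileTrue[OF s'(1,2) s''(1)] s''(3) by blast
qed

text \<open>Computes a power of -1 without multiplication: register 5 counts down by the 1 in
  register 1, and each round negates register 6 by subtracting it from the 0 in register 0.\<close>

definition parity_loop :: program where
  "parity_loop = WhilePos 5 (Seq (Sub 5 5 1) (Sub 6 0 6))"

lemma wp_parity_loop: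
  assumes "r 0 = 0" "r 1 = 1" "r 5 = int k" "r 6 = 1"
  shows "wp parity_loop (\<lambda>t s. t \<le> 3 * k + 1 \<and> s = (r(5 := 0, 6 := (- 1) ^ k), m)) (r, m)"
proof -
  define I where "I = (\<lambda>j s. j \<le> k \<and> s = (r(5 := int j, 6 := (- 1) ^ (k - j)), m))"
  have "wp parity_loop (\<lambda>t s. t \<le> k * (2 + 1) + 1 \<and> I 0 s) (r, m)"
    unfolding parity_loop_def
  proof (rule wp_while)
    show "I k (r, m)" using assms by (auto simp: I_def fun_eq_iff)
  next
    fix s assume "I 0 s"
    then show "\<not> 0 < fst s 5" by (simp add: I_def)
  next
    fix j s assume "I (Suc j) s"
    moreover have "k - j = Suc (k - Suc j)" if "Suc j \<le> k" using that by simp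
    ultimately show "fst s 5 > 0 \<and> wp (Seq (Sub 5 5 1) (Sub 6 0 6)) (\<lambda>t s'. t \<le> 2 \<and> I j s') s"
      using assms by (auto simp: I_def fun_eq_iff)
  qed
  then show ?thesis by (rule wp_mono) (simp add: I_def)
qed

text \<open>Squares are coloured relative to the first listed one: the coordinates themselves may be
  arbitrarily large, but their differences are bounded in terms of the number of squares.\<close>

definition count_body :: program where
  "count_body =
     Seq (Add 3 3 1) (Seq (Load 5 3) (Seq (Add 3 3 1) (Seq (Load 6 3)
    (Seq (Add 5 5 6) (Seq (Sub 5 5 4) (Seq (IfPos 5 Skip (Sub 5 0 5))
    (Seq (Const 6 1) (Seq parity_loop (Seq (Add 7 7 6) (Sub 2 2 1))))))))))"

text \<open>Registers: 1 holds the constant 1, 2 the number of squares left, 3 the last address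
  read, 4 the coordinate sum of the first square, 7 the signed count, 8 the number of squares; 5 and
  6 are scratch. Register 0 stays 0 until the answer.\<close>

definition init_balance :: program where
  "init_balance =
     Seq (Const 1 1) (Seq (Load 2 0) (Seq (Add 8 2 0) (Seq (Load 4 1)
    (Seq (Add 3 1 1) (Seq (Load 5 3) (Seq (Add 4 4 5) (Const 3 0)))))))"

text \<open>The bound on the absolute value is checked as two sign tests. Register 0 still holds 0,
  so a failing test answers no.\<close>

definition test_balance :: program where
  "test_balance =
     Seq (Add 7 7 7) (Seq (Sub 5 7 8) (Seq (Sub 6 0 7) (Seq (Sub 6 6 8)
    (IfPos 5 Skip (IfPos 6 Skip (Const 0 1))))))"

definition balance_program :: program where
  "balance_program = Seq init_balance (Seq (WhilePos 2 count_body) test_balance)"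

section \<open>Layout of the input in memory\<close>

lemma length_encode: "length (encode cs) = 2 * length cs + 1"
  unfolding encode_def by (induction cs) auto

lemma encode_nth:
  assumes "i < length cs"
  shows "encode cs ! (2 * i + 1) = fst (cs ! i)" "encode cs ! (2 * i + 2) = snd (cs ! i)"
proof -
  have "concat (map (\<lambda>(x, y). [x, y]) cs) ! (2 * i) = fst (cs ! i) \<and>
        concat (map (\<lambda>(x, y). [x, y]) cs) ! (2 * i + 1) = snd (cs ! i)"
    using assms
  proof (induction cs arbitrary: i)
    case Nil
    then show ?case by simp
  next
    case (Cons a cs)
    then show ?case by (cases i) (auto split: prod.splits)
  qed
  then show "encode cs ! (2 * i + 1) = fst (cs ! i)" "encode cs ! (2 * i + 2) = snd (cs ! i)"
    by (simp_all add: encode_def)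
qed

section \<open>Correctness and running time\<close>

lemma wp_count_body:
  fixes r :: "nat \<Rightarrow> int"
  assumes "r 0 = 0" "r 1 = 1"
    and x: "m (r 3 + 1) = x" and y: "m (r 3 + 2) = y"
    and D: "nat \<bar>x + y - r 4\<bar> \<le> D"
  shows "wp count_body (\<lambda>t s'. t \<le> 3 * D + 13 \<and> (\<exists>r'. s' = (r', m) \<and> r' 0 = 0 \<and> r' 1 = 1 \<and>
     r' 2 = r 2 - 1 \<and> r' 3 = r 3 + 2 \<and> r' 4 = r 4 \<and> r' 8 = r 8 \<and>
     r' 7 = r 7 + (- 1) ^ nat \<bar>x + y - r 4\<bar>)) (r, m)"
proof -
  define k where "k = nat \<bar>x + y - r 4\<bar>"
  \<comment> \<open>Continuation form of the loop rule: an arbitrary \<open>\<Phi>\<close> lets it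
    apply in the middle of the program.\<close>
  have loop: "wp parity_loop \<Phi> (\<rho>, m)"
    if "\<rho> 0 = 0" "\<rho> 1 = 1" "\<rho> 5 = int k" "\<rho> 6 = 1"
      "\<And>t. t \<le> 3 * k + 1 \<Longrightarrow> \<Phi> t (\<rho>(5 := 0, 6 := (- 1) ^ k), m)" for \<Phi> \<rho>
    by (rule wp_mono[OF wp_parity_loop[of \<rho> k m]]) (use that in auto)
  have kD: "k \<le> D" using D by (simp add: k_def)
  \<comment> \<open>The \<open>IfPos\<close> in the body computes an absolute value; these are its
    two branches, with 0 in the second.\<close>
  have sign_cases: "0 < x + y - r 4 \<and> int k = x + y - r 4 \<or>
      \<not> 0 < x + y - r 4 \<and> int k = r 4 - (x + y)"
    unfolding k_def by linarith
  show ?thesis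
    unfolding count_body_def k_def[symmetric] using sign_cases
  proof (elim disjE conjE, goal_cases)
    case 1
    then show ?case
      by (simp add: assms(1,2) x y add.assoc del: One_nat_def, intro loop)
        (use kD in \<open>simp_all add: assms(1,2) del: One_nat_def\<close>)
  next
    case 2
    then show ?case
      by (simp add: assms(1,2) x y add.assoc del: One_nat_def, intro loop)
        (use kD in \<open>simp_all add: assms(1,2) del: One_nat_def\<close>)
  qed
qed

text \<open>Some path from \<open>c\<close> to \<open>d\<close> has at most as many steps as there
  are adjacent pairs in \<open>R\<close>, and each step changes the coordinate sum by at most 1.
  This keeps the parity loop polynomial however large the coordinates are.\<close>

lemma coordinate_sum_bound:
  assumes "finite R" "connected_cells R" "c \<in> R" "d \<in> R"
  shows "nat \<bar>fst c + snd c - (fst d + snd d)\<bar> \<le> card R * card R"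
proof -
  define E where "E = {(u, v). u \<in> R \<and> v \<in> R \<and> adjacent u v}"
  have sub: "E \<subseteq> R \<times> R" by (auto simp: E_def)
  then have fin: "finite E" using assms(1) finite_subset by blast
  have card: "card E \<le> card R * card R"
    using card_mono[OF _ sub] assms(1) by (simp add: card_cartesian_product)
  have "(c, d) \<in> E\<^sup>*"
    using assms unfolding connected_cells_def E_def by blast
  then obtain k where k: "k \<le> card E" "(c, d) \<in> E ^^ k"
    unfolding rtrancl_finite_eq_relpow[OF fin] by blast
  have "(c, d) \<in> E ^^ k \<Longrightarrow> \<bar>fst c + snd c - (fst d + snd d)\<bar> \<le> int k" for c d k
  proof (induction k arbitrary: d)
    case 0
    then show ?case by simp
  next
    case (Suc k)
    then obtain e where "(c, e) \<in> E ^^ k" "(e, d) \<in> E" by auto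
    then have "\<bar>fst c + snd c - (fst e + snd e)\<bar> \<le> int k" "adjacent e d"
      using Suc.IH by (auto simp: E_def)
    then show ?case unfolding adjacent_def by linarith
  qed
  from this[OF k(2)] show ?thesis using k(1) card by linarith
qed

text \<open>The parity of the difference tells whether the two squares have the same colour, which
  is also what the product of their signs expresses.\<close>

lemma relative_sign:
  "(- 1) ^ nat \<bar>fst c + snd c - (fst d + snd d)\<bar> = cell_sign d * cell_sign c"
proof -
  have "even (nat \<bar>fst c + snd c - (fst d + snd d)\<bar>) \<longleftrightarrow> (black c \<longleftrightarrow> black d)"
    unfolding black_def even_nat_iff[OF abs_ge_zero] by simp
  then show ?thesis by (simp add: cell_sign_def minus_one_power_iff)
qed

lemma wp_balance_program:
  assumes "polyomino (set cs)" "distinct cs"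
  defines "n \<equiv> length cs"
  shows "wp balance_program (\<lambda>t s. t \<le> 3 * n ^ 3 + 14 * n + 40 \<and>
    fst s 0 = (if tileable S_a (set cs) then 1 else 0)) (initial_state (encode cs))"
proof -
  have R: "finite (set cs)" "connected_cells (set cs)" "cs \<noteq> []"
    using assms(1) by (auto simp: polyomino_def)
  \<comment> \<open>A polyomino has a square, so \<open>cs ! 0\<close> can serve as the colour
    reference.\<close>
  then have n: "0 < n" by (simp add: n_def)
  have card: "card (set cs) = n" using assms(2) by (simp add: n_def distinct_card)
  define m where "m = (\<lambda>a. if 0 \<le> a \<and> a < int (length (encode cs)) then encode cs ! nat a else 0)"
  have m0: "m 0 = int n"
    by (simp add: m_def length_encode n_def) (simp add: encode_def)
  have mx: "m (2 * int i + 1) = fst (cs ! i)" and my: "m (2 * int i + 2) = snd (cs ! i)"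
    if "i < n" for i
  proof -
    have "nat (2 * int i + 1) = 2 * i + 1" "nat (2 * int i + 2) = 2 * i + 2" by simp_all
    then show "m (2 * int i + 1) = fst (cs ! i)" "m (2 * int i + 2) = snd (cs ! i)"
      using that encode_nth[of i cs] by (simp_all add: m_def length_encode n_def)
  qed
  define base where "base = fst (cs ! 0) + snd (cs ! 0)"
  \<comment> \<open>Signed count of the first \<open>k\<close> squares, those coloured like
    \<open>cs ! 0\<close> counting positively.\<close>
  define S where "S = (\<lambda>k. \<Sum>i<k. cell_sign (cs ! 0) * cell_sign (cs ! i))"
  \<comment> \<open>\<open>k\<close> squares are left, as the loop rule demands. Register 3 points
    at the last address read, because the body increments it before each load.\<close>
  define I where "I = (\<lambda>k (s :: state). \<exists>r. s = (r, m) \<and> k \<le> n \<and> r 0 = 0 \<and> r 1 = 1 \<and> r 2 = int k \<and>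
    r 3 = 2 * int (n - k) \<and> r 4 = base \<and> r 8 = int n \<and> r 7 = S (n - k))"
  have body: "fst s 2 > 0 \<and> wp count_body (\<lambda>t s'. t \<le> 3 * (n * n) + 13 \<and> I k s') s"
    if Is: "I (Suc k) s" for k s
  proof -
    obtain r where r: "s = (r, m)" "Suc k \<le> n" "r 0 = 0" "r 1 = 1" "r 2 = int (Suc k)"
      "r 3 = 2 * int (n - Suc k)" "r 4 = base" "r 8 = int n" "r 7 = S (n - Suc k)"
      using Is unfolding I_def by blast
    define i where "i = n - Suc k"
    have i: "i < n" "n - k = Suc i" using r(2) by (auto simp: i_def)
    have D: "nat \<bar>fst (cs ! i) + snd (cs ! i) - r 4\<bar> \<le> n * n"
      unfolding r(7) base_def card[symmetric]
      by (rule coordinate_sum_bound[OF R(1,2)]) (use i(1) n in \<open>auto simp: n_def\<close>)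
    have sign: "(- 1) ^ nat \<bar>fst (cs ! i) + snd (cs ! i) - r 4\<bar> =
        cell_sign (cs ! 0) * cell_sign (cs ! i)"
      unfolding r(7) base_def by (rule relative_sign)
    have step: "S (n - k) = S i + cell_sign (cs ! 0) * cell_sign (cs ! i)"
      by (simp add: S_def i(2))
    have "wp count_body (\<lambda>t s'. t \<le> 3 * (n * n) + 13 \<and> I k s') (r, m)"
    proof (rule wp_mono[OF wp_count_body[OF r(3,4) _ _ D]])
      show "m (r 3 + 1) = fst (cs ! i)" "m (r 3 + 2) = snd (cs ! i)"
        using mx[OF i(1)] my[OF i(1)] r(6) by (simp_all add: i_def)
    next
      fix t :: nat and s' :: state
      assume *: "t \<le> 3 * (n * n) + 13 \<and> (\<exists>r'. s' = (r', m) \<and> r' 0 = 0 \<and> r' 1 = 1 \<and>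
        r' 2 = r 2 - 1 \<and> r' 3 = r 3 + 2 \<and> r' 4 = r 4 \<and> r' 8 = r 8 \<and>
        r' 7 = r 7 + (- 1) ^ nat \<bar>fst (cs ! i) + snd (cs ! i) - r 4\<bar>)"
      then obtain r' where r': "s' = (r', m)" "r' 0 = 0" "r' 1 = 1" "r' 2 = r 2 - 1"
          "r' 3 = r 3 + 2" "r' 4 = r 4" "r' 8 = r 8"
          "r' 7 = r 7 + (- 1) ^ nat \<bar>fst (cs ! i) + snd (cs ! i) - r 4\<bar>"
        by blast
      have "I k s'"
      proof -
        have "r' 7 = S (n - k)" unfolding r'(8) sign r(9) step by (simp add: i_def)
        moreover have "r' 3 = 2 * int (n - k)"
          unfolding r'(5) r(6) i_def[symmetric] i(2) by simp
        ultimately show ?thesis unfolding I_def using r r' by simp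
      qed
      then show "t \<le> 3 * (n * n) + 13 \<and> I k s'" using * by blast
    qed
    then show ?thesis using r by simp
  qed
  have loop: "wp (WhilePos 2 count_body) (\<lambda>t s'. t \<le> n * (3 * (n * n) + 13 + 1) + 1 \<and> I 0 s') s"
    if "I n s" for s
    by (rule wp_while[where I = I, OF body _ that]) (auto simp: I_def)
  have S_n: "S n = cell_sign (cs ! 0) * (\<Sum>c\<in>set cs. cell_sign c)"
  proof -
    have "(\<Sum>c\<in>set cs. cell_sign c) = (\<Sum>i<n. cell_sign (cs ! i))"
      using assms(2)
      by (simp add: n_def sum.distinct_set_conv_list sum_list_sum_nth atLeast0LessThan)
    then show ?thesis by (simp add: S_def sum_distrib_left)
  qed
  \<comment> \<open>The sign of the reference square is 1 or -1 and disappears under the absolute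
    value.\<close>
  have "tileable S_a (set cs) \<longleftrightarrow> \<bar>2 * S n\<bar> \<le> int n"
    unfolding tileable_iff_sign_sum[OF assms(1)] card S_n
    by (simp add: cell_sign_def)
  also have "\<dots> \<longleftrightarrow> \<not> 2 * S n - int n > 0 \<and> \<not> - 2 * S n - int n > 0" by linarith
  finally have answer: "tileable S_a (set cs) \<longleftrightarrow>
    \<not> 2 * S n - int n > 0 \<and> \<not> - 2 * S n - int n > 0" .
  have m12: "m 1 = fst (cs ! 0)" "m 2 = snd (cs ! 0)"
    using mx[of 0] my[of 0] n by simp_all
  have init: "wp init_balance (\<lambda>t s. t = 8 \<and> I n s) (\<lambda>_. 0, m)"
    unfolding init_balance_def
    by (simp add: m0 m12 I_def base_def S_def del: One_nat_def)
  have final: "wp test_balance (\<lambda>t s'. t \<le> 7 \<and> fst s' 0 = (if tileable S_a (set cs) then 1 else 0)) s"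
    if I0: "I 0 s" for s
  proof -
    obtain r where r: "s = (r, m)" "r 0 = 0" "r 8 = int n" "r 7 = S n"
      using I0 by (auto simp: I_def)
    show ?thesis
      unfolding test_balance_def r(1) answer by (simp add: r)
  qed
  \<comment> \<open>The phases take 8, at most \<open>n * (3 * (n * n) + 14) + 1\<close> and at most
    7 units; their constants add up to 16, well below 40.\<close>
  have "n * (3 * (n * n) + 13 + 1) = 3 * n ^ 3 + 14 * n"
    by (simp add: power3_eq_cube algebra_simps)
  then have time: "t + (u + w) \<le> 3 * n ^ 3 + 14 * n + 40"
    if "t = 8" "u \<le> n * (3 * (n * n) + 13 + 1) + 1" "w \<le> 7" for t u w :: nat
    using that by linarith
  show ?thesis
    unfolding balance_program_def wp_Seq initial_state_def m_def[symmetric]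
  proof (rule wp_mono[OF init])
    fix t :: nat and s assume s: "t = 8 \<and> I n s"
    show "wp (WhilePos 2 count_body) (\<lambda>u. wp test_balance (\<lambda>w s'.
        t + (u + w) \<le> 3 * n ^ 3 + 14 * n + 40 \<and>
        fst s' 0 = (if tileable S_a (set cs) then 1 else 0))) s"
    proof (rule wp_mono[OF loop])
      show "I n s" using s by blast
    next
      fix u :: nat and s' assume s': "u \<le> n * (3 * (n * n) + 13 + 1) + 1 \<and> I 0 s'"
      show "wp test_balance (\<lambda>w s'. t + (u + w) \<le> 3 * n ^ 3 + 14 * n + 40 \<and>
          fst s' 0 = (if tileable S_a (set cs) then 1 else 0)) s'"
        by (rule wp_mono[OF final]) (use s s' time in blast)+
    qed
  qed
qed

theorem theorem3p10:
  "\<exists>(c :: program) (p :: nat poly). decides_in_time c (tileable S_a) (poly p)"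
proof (intro exI)
  \<comment> \<open>The coefficients are in ascending order and encode
    \<open>3 * n ^ 3 + 14 * n + 40\<close>.\<close>
  show "decides_in_time balance_program (tileable S_a) (poly [:40, 14, 0, 3:])"
    unfolding decides_in_time_def answers_within_def
  proof (intro allI impI)
    fix R cs assume R: "polyomino R \<and> distinct cs \<and> set cs = R"
    then have "card R = length cs" using distinct_card by blast
    then have "poly [:40, 14, 0, 3:] (card R) = 3 * length cs ^ 3 + 14 * length cs + 40"
      by (simp add: power3_eq_cube algebra_simps)
    then show "\<exists>t s. exec balance_program (initial_state (encode cs)) t s \<and>
        t \<le> poly [:40, 14, 0, 3:] (card R) \<and> fst s 0 = (if tileable S_a R then 1 else 0)"
      using wp_balance_program[of cs] R unfolding wp_def by metis
  qed
qed

end
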